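(* Let $\mathbb{P}$ be the set of primes, let $f \colon \mathbb{P} \to \mathbb{N}_0$ be a function with support $P = \{p \in \mathbb{P} : f(p) \neq 0\}$ such that $p \nmid f(p)$ for any $p \in P$, and let $M_f = \big\langle \frac{f(p)}{p} : p \in \mathbb{P} \big\rangle$ be the Puiseux monoid induced by $f$. Then $M_f$ satisfies the ascending chain condition on principal ideals (ACCP).
   Context: A Puiseux monoid is an additive submonoid of $\mathbb{Q}_{\ge 0}$, and $\langle S \rangle$ denotes the additive submonoid generated by $S$. A principal ideal of a monoid $M$ is a subset of the form $b + M$ with $b \in M$. $M$ satisfies the ACCP if for every sequence $(I_n)_{n \ge 1}$ of principal ideals of $M$ that is increasing under inclusion there exists $m \in \mathbb{N}$ such that $I_n = I_m$ for all $n \ge m$. Here $\mathbb{N}_0 = \{0,1,2,\dots\}$. *)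

theory Defs
  imports Complex_Main "HOL-Computational_Algebra.Primes"
begin

definition additive_submonoid :: "'a::comm_monoid_add set \<Rightarrow> bool" where
  "additive_submonoid M \<longleftrightarrow> 0 \<in> M \<and> (\<forall>x\<in>M. \<forall>y\<in>M. x + y \<in> M)"

definition submonoid_generated :: "'a::comm_monoid_add set \<Rightarrow> 'a set" where
  "submonoid_generated S = additive_submonoid hull S"

definition puiseux_monoid :: "rat set \<Rightarrow> bool" where
  "puiseux_monoid M \<longleftrightarrow> additive_submonoid M \<and> (\<forall>x\<in>M. 0 \<le> x)"

definition principal_ideal :: "'a::comm_monoid_add set \<Rightarrow> 'a set \<Rightarrow> bool" where
  "principal_ideal M I \<longleftrightarrow> (\<exists>b\<in>M. I = {b + x | x. x \<in> M})"

(* Sequences are indexed from 0 instead of 1; this is only a shift of the index. *)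
definition ACCP :: "'a::comm_monoid_add set \<Rightarrow> bool" where
  "ACCP M \<longleftrightarrow>
     (\<forall>I :: nat \<Rightarrow> 'a set. (\<forall>n. principal_ideal M (I n)) \<and> incseq I
        \<longrightarrow> (\<exists>m. \<forall>n\<ge>m. I n = I m))"

(* A function on the primes is represented by a function on nat;
   only its values at primes are used below. *)
definition prime_support :: "(nat \<Rightarrow> nat) \<Rightarrow> nat set" where
  "prime_support f = {p. prime p \<and> f p \<noteq> 0}"

definition induced_monoid :: "(nat \<Rightarrow> nat) \<Rightarrow> rat set" where
  "induced_monoid f = submonoid_generated {of_nat (f p) / of_nat p | p. prime p}"

lemma additive_submonoid_generated: "additive_submonoid (submonoid_generated S)"
  by (auto simp: submonoid_generated_def hull_def additive_submonoid_def)

lemma puiseux_monoid_induced_monoid: "puiseux_monoid (induced_monoid f)"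
proof -
  have "additive_submonoid {x :: rat. 0 \<le> x}"
    by (simp add: additive_submonoid_def)
  then have "induced_monoid f \<subseteq> {x. 0 \<le> x}"
    unfolding induced_monoid_def submonoid_generated_def
    by (intro hull_minimal) auto
  then show ?thesis
    unfolding puiseux_monoid_def
    by (auto simp: induced_monoid_def additive_submonoid_generated)
qed

end

theory Submission
  imports Defs
begin

text \<open>
  Since the numerator \<open>f p\<close> is a unit modulo \<open>p\<close>, every element of the monoid has a unique normal
  form \<open>n + (\<Sum>p. c p * f p / p)\<close> with \<open>n\<close> a natural number and digits \<open>c p < p\<close>. Adding two elements
  adds their integer parts \<open>n\<close>, plus \<open>f p > 0\<close> for every carry at \<open>p\<close>; when there is no carry, the
  digit sums add as well. Hence passing to a proper divisor strictly decreases the pair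
  (integer part, digit sum) in the lexicographic order on pairs of natural numbers.
\<close>

text \<open>In an ascending chain each generator is a later generator plus an element of
  \<open>M\<close>, so \<open>\<mu>\<close> drops along \<open>r\<close> whenever the ideal grows
  properly. The chain is therefore stationary from a generator of minimal measure on.\<close>

lemma ACCP_if_wf:
  fixes M :: "'a::comm_monoid_add set"
  assumes "wf r"
    and decr: "\<And>b x. b \<in> M \<Longrightarrow> x \<in> M \<Longrightarrow> x \<noteq> 0 \<Longrightarrow> (\<mu> b, \<mu> (b + x)) \<in> r"
    and "0 \<in> M"
  shows "ACCP M"
  unfolding ACCP_def
proof (intro allI impI, elim conjE)
  fix I :: "nat \<Rightarrow> 'a set"
  assume "\<forall>n. principal_ideal M (I n)" and inc: "incseq I"
  define J where "J b = {b + x | x. x \<in> M}" for b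
  have "\<forall>n. \<exists>b. b \<in> M \<and> I n = J b"
    using \<open>\<forall>n. principal_ideal M (I n)\<close> unfolding principal_ideal_def J_def by blast
  then obtain b where b: "\<And>n. b n \<in> M" and I: "\<And>n. I n = J (b n)"
    by metis
  have "\<exists>m. \<forall>y. (y, \<mu> (b m)) \<in> r \<longrightarrow> y \<notin> range (\<lambda>n. \<mu> (b n))"
    using wfE_min[OF \<open>wf r\<close> rangeI[of "\<lambda>n. \<mu> (b n)" 0]] by (metis (no_types, lifting) rangeE)
  then obtain m where min: "\<And>n. (\<mu> (b n), \<mu> (b m)) \<notin> r"
    by blast
  have "I n = I m" if "n \<ge> m" for n
  proof -
    have "b m \<in> I m"
      unfolding I J_def using \<open>0 \<in> M\<close> by (auto intro!: exI[of _ 0])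
    then have "b m \<in> I n"
      using inc that by (meson incseqD subsetD)
    then obtain x where x: "x \<in> M" "b m = b n + x"
      unfolding I J_def by blast
    \<comment> \<open>Otherwise \<open>b n\<close> would have smaller measure than the minimal
      \<open>b m\<close>.\<close>
    then have "x = 0"
      using decr[OF b[of n] x(1)] min[of n] by auto
    then show ?thesis
      using x I by simp
  qed
  then show "\<exists>m. \<forall>n\<ge>m. I n = I m" by blast
qed

lemma prod_mult_sum_fractions_in_Ints:
  fixes a :: "nat \<Rightarrow> int"
  assumes "finite B" "0 \<notin> B"
  shows "rat_of_nat (\<Prod>B) * (\<Sum>q\<in>B. of_int (a q) / of_nat q) \<in> \<int>"
  unfolding sum_distrib_left
proof (rule Ints_sum)
  fix q assume q: "q \<in> B"
  then have "rat_of_nat (\<Prod>B) = of_nat q * of_nat (\<Prod>(B - {q}))"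
    using assms by (simp add: prod.remove[of B q])
  then have "rat_of_nat (\<Prod>B) * (of_int (a q) / of_nat q) = of_int (a q * int (\<Prod>(B - {q})))"
    using q assms by (cases "q = 0") simp_all
  then show "rat_of_nat (\<Prod>B) * (of_int (a q) / of_nat q) \<in> \<int>"
    by (metis Ints_of_int)
qed

text \<open>Multiplying by the product \<open>Q\<close> of the other primes clears every denominator
  except \<open>p\<close>. Thus \<open>p\<close> divides \<open>Q * a p\<close>, but it does not
  divide \<open>Q\<close>.\<close>

lemma prime_dvd_numerator_of_integral_sum:
  fixes a :: "nat \<Rightarrow> int"
  assumes "finite A" and primes: "\<And>q. q \<in> A \<Longrightarrow> prime q" and "p \<in> A"
    and int_sum: "(\<Sum>q\<in>A. rat_of_int (a q) / of_nat q) \<in> \<int>"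
  shows "int p dvd a p"
proof -
  define Q where "Q = \<Prod>(A - {p})"
  have p: "prime p" using assms by blast
  have "0 \<notin> A" using primes by (metis not_prime_0)
  then have "rat_of_nat Q * (\<Sum>q\<in>A - {p}. of_int (a q) / of_nat q) \<in> \<int>"
    unfolding Q_def using \<open>finite A\<close> by (intro prod_mult_sum_fractions_in_Ints) auto
  moreover have "rat_of_nat Q * (\<Sum>q\<in>A. of_int (a q) / of_nat q) \<in> \<int>"
    using int_sum by (intro Ints_mult) auto
  ultimately have "rat_of_nat Q * (\<Sum>q\<in>A. of_int (a q) / of_nat q)
      - rat_of_nat Q * (\<Sum>q\<in>A - {p}. of_int (a q) / of_nat q) \<in> \<int>"
    by (rule Ints_diff[rotated])
  then have "rat_of_nat Q * (of_int (a p) / of_nat p) \<in> \<int>"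
    using assms by (simp add: sum.remove[of A p] distrib_left)
  then obtain k where "rat_of_nat Q * (of_int (a p) / of_nat p) = of_int k"
    by (auto elim: Ints_cases)
  then have "rat_of_int (int Q * a p) = of_int (k * int p)"
    using prime_gt_0_nat[OF p] by (simp add: field_simps)
  then have "int p dvd int Q * a p"
    by (metis dvd_triv_right of_int_eq_iff)
  moreover have "\<not> p dvd Q"
    unfolding Q_def using \<open>finite A\<close> p
    by (subst prime_dvd_prod_iff) (auto dest: primes_dvd_imp_eq[OF p primes])
  ultimately show ?thesis
    using p by (simp add: prime_dvd_mult_iff)
qed

text \<open>Digits live on \<open>prime_support f\<close> only: where \<open>f p = 0\<close>, the
  value \<open>q\<close> would not determine the digit. Total functions that are 0 off the support
  allow uniqueness to be stated as \<open>c = d\<close>.\<close>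

definition normal_form :: "(nat \<Rightarrow> nat) \<Rightarrow> rat \<Rightarrow> nat \<Rightarrow> (nat \<Rightarrow> nat) \<Rightarrow> bool" where
  "normal_form f q n c \<longleftrightarrow>
     finite {p. c p \<noteq> 0} \<and> (\<forall>p. c p \<noteq> 0 \<longrightarrow> p \<in> prime_support f \<and> c p < p) \<and>
     q = of_nat n + (\<Sum>p | c p \<noteq> 0. of_nat (c p * f p) / of_nat p)"

text \<open>Over a common finite index set, two normal forms can be compared or added term by
  term.\<close>

lemma normal_form_sum_superset:
  assumes "normal_form f q n c" "finite A" "{p. c p \<noteq> 0} \<subseteq> A"
  shows "q = of_nat n + (\<Sum>p\<in>A. of_nat (c p * f p) / of_nat p)"
proof -
  have "(\<Sum>p | c p \<noteq> 0. rat_of_nat (c p * f p) / of_nat p)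
      = (\<Sum>p\<in>A. of_nat (c p * f p) / of_nat p)"
    using assms by (intro sum.mono_neutral_left) auto
  then show ?thesis
    using assms by (simp add: normal_form_def)
qed

text \<open>Subtracting the two forms leaves an integral sum of fractions with distinct prime
  denominators, so \<open>p\<close> divides \<open>(c p - d p) * f p\<close>. As \<open>p\<close>
  does not divide \<open>f p\<close>, the digits agree modulo \<open>p\<close>, and both are below
  \<open>p\<close>.\<close>

lemma normal_form_unique:
  assumes coprime: "\<forall>p\<in>prime_support f. \<not> p dvd f p"
    and c: "normal_form f q n c" and d: "normal_form f q m d"
  shows "n = m" and "c = d"
proof -
  define A where "A = {p. c p \<noteq> 0} \<union> {p. d p \<noteq> 0}"
  have fin: "finite A" and supp: "A \<subseteq> prime_support f"
    using c d by (auto simp: A_def normal_form_def)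
  then have primes: "\<And>p. p \<in> A \<Longrightarrow> prime p"
    by (auto simp: prime_support_def)
  have qc: "q = of_nat n + (\<Sum>p\<in>A. of_nat (c p * f p) / of_nat p)"
    using c fin by (rule normal_form_sum_superset) (auto simp: A_def)
  have qd: "q = of_nat m + (\<Sum>p\<in>A. of_nat (d p * f p) / of_nat p)"
    using d fin by (rule normal_form_sum_superset) (auto simp: A_def)
  define a where "a p = (int (c p) - int (d p)) * int (f p)" for p
  have "(\<Sum>p\<in>A. rat_of_int (a p) / of_nat p)
      = (\<Sum>p\<in>A. of_nat (c p * f p) / of_nat p) - (\<Sum>p\<in>A. of_nat (d p * f p) / of_nat p)"
    unfolding sum_subtractf[symmetric]
    by (rule sum.cong) (auto simp: a_def left_diff_distrib diff_divide_distrib)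
  also have "\<dots> = of_int (int m - int n)"
    using qc qd by simp
  finally have "(\<Sum>p\<in>A. rat_of_int (a p) / of_nat p) \<in> \<int>"
    by simp
  then have dvd: "int p dvd a p" if "p \<in> A" for p
    using prime_dvd_numerator_of_integral_sum fin primes that by blast
  have "c p = d p" for p
  proof (cases "p \<in> A")
    case True
    then have p: "prime p" "\<not> p dvd f p" and less: "c p < p" "d p < p"
      using primes coprime supp c d unfolding normal_form_def
      by (blast, blast, (metis prime_gt_0_nat)+)
    have "int p dvd int (c p) - int (d p)"
      using dvd[OF True] p by (simp add: a_def prime_dvd_mult_iff)
    then have "int (c p) mod int p = int (d p) mod int p"
      by (simp add: mod_eq_dvd_iff)
    then show ?thesis using less by simp
  qed (auto simp: A_def)
  then show "c = d" by blast
  then show "n = m" using qc qd by simp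
qed

text \<open>This is addition with carry: \<open>p\<close> copies of \<open>f p / p\<close> amount to
  the integer \<open>f p\<close>, which moves into the integer part.\<close>

lemma normal_form_add:
  assumes c: "normal_form f a n c" and d: "normal_form f b m d"
  obtains k e where "normal_form f (a + b) k e" "n + m \<le> k"
    "k = n + m \<Longrightarrow> sum e {p. e p \<noteq> 0} = sum c {p. c p \<noteq> 0} + sum d {p. d p \<noteq> 0}"
proof -
  define A where "A = {p. c p \<noteq> 0} \<union> {p. d p \<noteq> 0}"
  have fin: "finite A" and supp: "A \<subseteq> prime_support f"
    using c d by (auto simp: A_def normal_form_def)
  have pos: "p > 0" if "p \<in> A" for p
    using supp that by (auto simp: prime_support_def dest: prime_gt_0_nat)
  define e where "e p = (c p + d p) mod p" for p
  define k where "k = n + m + (\<Sum>p\<in>A. (c p + d p) div p * f p)"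
  have eA: "{p. e p \<noteq> 0} \<subseteq> A"
    by (auto simp: A_def e_def intro!: gr0I)
  have "of_nat (c p * f p) / of_nat p + of_nat (d p * f p) / of_nat p
      = rat_of_nat ((c p + d p) div p * f p) + of_nat (e p * f p) / of_nat p" if "p \<in> A" for p
  proof -
    have "rat_of_nat (c p + d p) = of_nat ((c p + d p) div p * p + e p)"
      by (simp add: e_def)
    then have "rat_of_nat (c p) + of_nat (d p) = of_nat ((c p + d p) div p) * of_nat p + of_nat (e p)"
      by (simp only: of_nat_add of_nat_mult)
    then have "(rat_of_nat (c p) + of_nat (d p)) * of_nat (f p) / of_nat p
        = (of_nat ((c p + d p) div p) * of_nat p + of_nat (e p)) * of_nat (f p) / of_nat p"
      by simp
    then show ?thesis
      using pos[OF that] by (simp add: field_simps del: of_nat_add)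
  qed
  then have "(\<Sum>p\<in>A. rat_of_nat (c p * f p) / of_nat p) + (\<Sum>p\<in>A. of_nat (d p * f p) / of_nat p)
      = of_nat (\<Sum>p\<in>A. (c p + d p) div p * f p) + (\<Sum>p\<in>A. of_nat (e p * f p) / of_nat p)"
    unfolding of_nat_sum sum.distrib[symmetric] by (intro sum.cong) auto
  moreover have "a = of_nat n + (\<Sum>p\<in>A. of_nat (c p * f p) / of_nat p)"
    using c fin by (rule normal_form_sum_superset) (auto simp: A_def)
  moreover have "b = of_nat m + (\<Sum>p\<in>A. of_nat (d p * f p) / of_nat p)"
    using d fin by (rule normal_form_sum_superset) (auto simp: A_def)
  ultimately have "a + b = of_nat k + (\<Sum>p\<in>A. of_nat (e p * f p) / of_nat p)"
    by (simp add: k_def)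
  also have "(\<Sum>p\<in>A. of_nat (e p * f p) / rat_of_nat p) = (\<Sum>p | e p \<noteq> 0. of_nat (e p * f p) / of_nat p)"
    using fin eA by (intro sum.mono_neutral_right) auto
  finally have "normal_form f (a + b) k e"
    using fin eA supp pos by (auto simp: normal_form_def e_def intro: finite_subset)
  moreover have "n + m \<le> k" by (simp add: k_def)
  moreover have "sum e {p. e p \<noteq> 0} = sum c {p. c p \<noteq> 0} + sum d {p. d p \<noteq> 0}" if "k = n + m"
  proof -
    \<comment> \<open>If the integer part gains nothing, every carry term vanishes; since
      \<open>f p\<close> is positive, the quotient itself is 0 and reduction modulo \<open>p\<close>
      changes nothing.\<close>
    have "e p = c p + d p" if "p \<in> A" for p
    proof -
      have "(c p + d p) div p * f p = 0"
        using \<open>k = n + m\<close> fin that by (simp add: k_def)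
      moreover have "f p \<noteq> 0"
        using supp that by (auto simp: prime_support_def)
      ultimately show ?thesis
        using pos[OF that] by (auto simp: e_def div_eq_0_iff)
    qed
    then have "sum e A = sum c A + sum d A"
      by (simp add: sum.distrib)
    moreover have "sum e {p. e p \<noteq> 0} = sum e A"
      using fin eA by (intro sum.mono_neutral_left) auto
    moreover have "sum c {p. c p \<noteq> 0} = sum c A" "sum d {p. d p \<noteq> 0} = sum d A"
      using fin by (auto intro!: sum.mono_neutral_left simp: A_def)
    ultimately show ?thesis by simp
  qed
  ultimately show ?thesis by (rule that)
qed

lemma normal_form_zero: "normal_form f 0 0 (\<lambda>_. 0)"
  by (simp add: normal_form_def)

lemma normal_form_generator:
  assumes "p \<in> prime_support f"
  shows "normal_form f (of_nat (f p) / of_nat p) 0 (\<lambda>q. if q = p then 1 else 0)"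
proof -
  have "1 < p" using assms by (auto simp: prime_support_def dest: prime_gt_1_nat)
  then show ?thesis using assms by (simp add: normal_form_def)
qed

text \<open>The rationals with a normal form constitute a submonoid containing all
  generators.\<close>

lemma normal_form_exists:
  assumes "q \<in> induced_monoid f"
  shows "\<exists>n c. normal_form f q n c"
proof -
  have "\<exists>n c. normal_form f (a + b) n c"
    if "\<exists>n c. normal_form f a n c" "\<exists>n c. normal_form f b n c" for a b
    using that by (elim exE) (erule normal_form_add, assumption, intro exI)
  then have "additive_submonoid {q. \<exists>n c. normal_form f q n c}"
    unfolding additive_submonoid_def using normal_form_zero[of f] by auto
  moreover have "{of_nat (f p) / of_nat p | p. prime p} \<subseteq> {q. \<exists>n c. normal_form f q n c}"
  proof clarify
    fix p :: nat assume "prime p"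
    \<comment> \<open>A prime outside the support contributes the generator 0.\<close>
    then show "\<exists>n c. normal_form f (of_nat (f p) / of_nat p) n c"
      using normal_form_generator[of p f] normal_form_zero[of f]
      by (cases "f p = 0") (auto simp: prime_support_def)
  qed
  ultimately have "induced_monoid f \<subseteq> {q. \<exists>n c. normal_form f q n c}"
    unfolding induced_monoid_def submonoid_generated_def by (intro hull_minimal)
  then show ?thesis using assms by auto
qed

theorem theorem5p9:
  fixes f :: "nat \<Rightarrow> nat"
  assumes "\<forall>p \<in> prime_support f. \<not> p dvd f p"
  shows "ACCP (induced_monoid f)"
proof -
  \<comment> \<open>Integer part \<open>N\<close> and digits \<open>C\<close> become functions on
    the monoid; with the digit sum \<open>S\<close> they provide the measure.\<close>
  have "\<exists>N. \<forall>q\<in>induced_monoid f. \<exists>c. normal_form f q (N q) c"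
    by (intro bchoice ballI normal_form_exists)
  then obtain N where "\<forall>q\<in>induced_monoid f. \<exists>c. normal_form f q (N q) c" ..
  then have "\<exists>C. \<forall>q\<in>induced_monoid f. normal_form f q (N q) (C q)"
    by (rule bchoice)
  then obtain C where NC: "\<And>q. q \<in> induced_monoid f \<Longrightarrow> normal_form f q (N q) (C q)"
    by blast
  define S where "S q = sum (C q) {p. C q p \<noteq> 0}" for q
  have submonoid: "additive_submonoid (induced_monoid f)"
    unfolding induced_monoid_def by (rule additive_submonoid_generated)
  have "wf (less_than <*lex*> less_than)" by auto
  then show ?thesis
  proof (rule ACCP_if_wf)
    fix b x assume b: "b \<in> induced_monoid f" and x: "x \<in> induced_monoid f" and "x \<noteq> 0"
    have "b + x \<in> induced_monoid f"
      using submonoid b x by (auto simp: additive_submonoid_def)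
    note bx = NC[OF this]
    obtain k e where
      ke: "normal_form f (b + x) k e" "N b + N x \<le> k"
      and sum: "k = N b + N x \<Longrightarrow> sum e {p. e p \<noteq> 0} = S b + S x"
      unfolding S_def by (rule normal_form_add[OF NC[OF b] NC[OF x]]) blast
    \<comment> \<open>Uniqueness identifies the chosen form of \<open>b + x\<close> with the one
      computed by carrying.\<close>
    have k: "N (b + x) = k" and e: "C (b + x) = e"
      using normal_form_unique[OF assms bx ke(1)] by auto
    have "N x > 0 \<or> S x > 0"
    proof (rule ccontr)
      assume "\<not> (N x > 0 \<or> S x > 0)"
      then have "N x = 0" "{p. C x p \<noteq> 0} = {}"
        using NC[OF x] by (auto simp: S_def normal_form_def)
      then show False
        using NC[OF x] \<open>x \<noteq> 0\<close> by (simp add: normal_form_def)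
    qed
    moreover have "S (b + x) = S b + S x" if "N (b + x) = N b + N x"
      using sum that unfolding S_def[of "b + x"] k e by blast
    \<comment> \<open>Either the integer part grows, or \<open>N x = 0\<close> and no carry occurs;
      then \<open>S x > 0\<close> and the digit sum grows by \<open>S x\<close>.\<close>
    ultimately show "((N b, S b), (N (b + x), S (b + x))) \<in> less_than <*lex*> less_than"
      using ke(2) k by (cases "N x = 0") (auto simp: le_less)
  next
    show "0 \<in> induced_monoid f"
      using submonoid by (simp add: additive_submonoid_def)
  qed
qed

end
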